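(* For all real numbers $x > 0$ and $c > 0$, $$\lim_{m \to \infty} \beta^2_m(x, c) = \sqrt{x},$$ where $m$ ranges over the positive integers.
   Context: For a positive integer $m$ and real numbers $x>0$, $c>0$, the square-root (binomial) biroot approximant of order $m$ is $$\beta^2_m(x,c) = \frac{\displaystyle\sum_{k=0}^{\lceil m/2 \rceil} x^k\, c^{m-2k} \binom{m}{2k}}{\displaystyle\sum_{k=0}^{\lceil m/2 \rceil - 1} x^k\, c^{m-2k-1} \binom{m}{2k+1}}.$$ Binomial coefficients $\binom{a}{b}$ with $b>a\ge 0$ are equal to $0$. Exponents of $c$ are integers and may be negative (in which case the binomial coefficient vanishes). *)

theory Defs
  imports Complex_Main
begin

text \<open>
  The square-root (binomial) biroot approximant of order \<open>m \<ge> 1\<close>. The exponents of \<open>c\<close> are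
  integers, as \<open>m - 2k\<close> is negative for the last summand of the numerator when \<open>m\<close> is odd.
  The value at \<open>m = 0\<close> is a junk value (division by zero) with no mathematical meaning.
\<close>

definition biroot2 :: "nat \<Rightarrow> real \<Rightarrow> real \<Rightarrow> real" where
  "biroot2 m x c =
     (\<Sum>k = 0..nat \<lceil>real m / 2\<rceil>.
        x ^ k * c powi (int m - 2 * int k) * real (m choose (2 * k))) /
     (\<Sum>k = 0..nat (\<lceil>real m / 2\<rceil> - 1).
        x ^ k * c powi (int m - 2 * int k - 1) * real (m choose (2 * k + 1)))"

end

theory Submission
  imports Defs
begin

text \<open>
  Splitting the binomial expansions of \<open>(c + s)\<^sup>m\<close> and \<open>(c - s)\<^sup>m\<close>, with \<open>s\<^sup>2 = x\<close>, into even and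
  odd powers of \<open>s\<close> gives \<open>N + s D\<close> and \<open>N - s D\<close>, where \<open>N / D\<close> is the approximant. Hence the
  approximant equals \<open>s (1 + r\<^sup>m) / (1 - r\<^sup>m)\<close> with \<open>r = (c - s) / (c + s)\<close>, and \<open>\<bar>r\<bar> < 1\<close>.
\<close>

text \<open>The range \<open>k \<le> m\<close> replaces the ceilings: it covers every nonzero
  binomial coefficient, whatever the parity of \<open>m\<close>.\<close>

definition biroot2_num :: "nat \<Rightarrow> real \<Rightarrow> real \<Rightarrow> real" where
  "biroot2_num m x c =
     (\<Sum>k\<le>m. x ^ k * c powi (int m - 2 * int k) * real (m choose (2 * k)))"

definition biroot2_den :: "nat \<Rightarrow> real \<Rightarrow> real \<Rightarrow> real" where
  "biroot2_den m x c =
     (\<Sum>k\<le>m. x ^ k * c powi (int m - 2 * int k - 1) * real (m choose (2 * k + 1)))"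

lemma sum_even_odd_atMost:
  fixes f :: "nat \<Rightarrow> 'a::comm_monoid_add"
  shows "(\<Sum>j\<le>2 * n + 1. f j) = (\<Sum>k\<le>n. f (2 * k)) + (\<Sum>k\<le>n. f (2 * k + 1))"
  by (induction n) (simp_all add: ac_simps)

text \<open>Allowing either square root of \<open>x\<close> as \<open>s\<close> lets one expansion
  serve both \<open>c + sqrt x\<close> and \<open>c - sqrt x\<close>.\<close>

lemma binomial_even_odd:
  fixes s c x :: real
  assumes "s\<^sup>2 = x" and "c \<noteq> 0"
  shows "(c + s) ^ m = biroot2_num m x c + s * biroot2_den m x c"
proof -
  define f where "f j = real (m choose j) * s ^ j * c powi (int m - int j)" for j
  have "(c + s) ^ m = (\<Sum>j\<le>m. f j)"
  proof -
    have "(c + s) ^ m = (\<Sum>j\<le>m. real (m choose j) * s ^ j * c ^ (m - j))"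
      by (metis add.commute binomial_ring)
    also have "\<dots> = (\<Sum>j\<le>m. f j)"
      by (intro sum.cong) (auto simp: f_def simp flip: of_nat_diff)
    finally show ?thesis .
  qed
  \<comment> \<open>Padding to an odd upper bound makes the indices pair up as \<open>2 * k\<close>,
    \<open>2 * k + 1\<close>; the added terms vanish since \<open>m choose j = 0\<close> for
    \<open>j > m\<close>.\<close>
  also have "\<dots> = (\<Sum>j\<le>2 * m + 1. f j)"
    by (intro sum.mono_neutral_left) (auto simp: f_def)
  also have "\<dots> = (\<Sum>k\<le>m. f (2 * k)) + (\<Sum>k\<le>m. f (2 * k + 1))"
    by (rule sum_even_odd_atMost)
  also have "(\<Sum>k\<le>m. f (2 * k)) = biroot2_num m x c"
    unfolding biroot2_num_def f_def using assms(1)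
    by (intro sum.cong) (auto simp: power_mult)
  also have "(\<Sum>k\<le>m. f (2 * k + 1)) = s * biroot2_den m x c"
    unfolding biroot2_den_def f_def sum_distrib_left using assms(1)
    by (intro sum.cong) (auto simp: algebra_simps simp flip: power_mult)
  finally show ?thesis .
qed

text \<open>The ranges differ only in terms whose binomial coefficient is 0. For
  \<open>m > 0\<close> the ceiling is at least 1, so \<open>nat\<close> does not truncate the bound
  of the denominator.\<close>

lemma biroot2_eq_num_div_den:
  assumes "m > 0"
  shows "biroot2 m x c = biroot2_num m x c / biroot2_den m x c"
proof -
  have ceil: "2 * \<lceil>real m / 2\<rceil> \<ge> int m" "\<lceil>real m / 2\<rceil> \<le> int m" "\<lceil>real m / 2\<rceil> \<ge> 1"
    using assms by linarith+
  have "(\<Sum>k = 0..nat \<lceil>real m / 2\<rceil>. x ^ k * c powi (int m - 2 * int k) * real (m choose (2 * k)))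
      = biroot2_num m x c"
    unfolding biroot2_num_def using ceil
    by (intro sum.mono_neutral_left) auto
  moreover have "(\<Sum>k = 0..nat (\<lceil>real m / 2\<rceil> - 1).
        x ^ k * c powi (int m - 2 * int k - 1) * real (m choose (2 * k + 1))) = biroot2_den m x c"
    unfolding biroot2_den_def
  proof (intro sum.mono_neutral_left ballI)
    fix k assume "k \<in> {..m} - {0..nat (\<lceil>real m / 2\<rceil> - 1)}"
    then have "m < 2 * k + 1" using ceil by auto
    then show "x ^ k * c powi (int m - 2 * int k - 1) * real (m choose (2 * k + 1)) = 0"
      by simp
  qed (use ceil in auto)
  ultimately show ?thesis by (simp add: biroot2_def)
qed

theorem theorem3p3:
  fixes x c :: real
  assumes "x > 0" and "c > 0"
  shows "(\<lambda>m. biroot2 m x c) \<longlonglongrightarrow> sqrt x"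
proof -
  define s where "s = sqrt x"
  define r where "r = (c - s) / (c + s)"
  have s: "s > 0" "s\<^sup>2 = x" using assms by (auto simp: s_def)
  have r: "\<bar>r\<bar> < 1" using s assms by (auto simp: r_def abs_less_iff field_simps)
  have closed_form: "biroot2 m x c = s * (1 + r ^ m) / (1 - r ^ m)" if "m > 0" for m
  proof -
    have plus: "(c + s) ^ m = biroot2_num m x c + s * biroot2_den m x c"
      using binomial_even_odd[of s x c m] s assms by simp
    \<comment> \<open>Passing to the root \<open>- s\<close> flips the sign of the odd part
      only.\<close>
    have minus: "(c - s) ^ m = biroot2_num m x c - s * biroot2_den m x c"
      using binomial_even_odd[of "- s" x c m] s assms by simp
    have pos: "c + s > 0" "(c + s) ^ m > 0" using s assms by simp_all
    have "1 + r ^ m = 2 * biroot2_num m x c / (c + s) ^ m"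
      using pos plus minus by (simp add: r_def power_divide field_simps)
    moreover have "1 - r ^ m = 2 * s * biroot2_den m x c / (c + s) ^ m"
      using pos plus minus by (simp add: r_def power_divide field_simps)
    \<comment> \<open>In the quotient the factors 2, \<open>s\<close> and \<open>(c + s) ^ m\<close>
      cancel.\<close>
    ultimately show ?thesis
      using pos s by (simp add: biroot2_eq_num_div_den[OF that])
  qed
  have "(\<lambda>m. s * (1 + r ^ m) / (1 - r ^ m)) \<longlonglongrightarrow> s * (1 + 0) / (1 - 0)"
    using r by (intro tendsto_divide tendsto_mult tendsto_add tendsto_diff tendsto_const
        LIMSEQ_power_zero) simp_all
  \<comment> \<open>\<open>closed_form\<close> covers only \<open>m > 0\<close>, hence eventual
    equality.\<close>
  moreover have "\<forall>\<^sub>F m in sequentially. s * (1 + r ^ m) / (1 - r ^ m) = biroot2 m x c"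
    using eventually_gt_at_top[of 0] by eventually_elim (simp add: closed_form)
  ultimately have "(\<lambda>m. biroot2 m x c) \<longlonglongrightarrow> s * (1 + 0) / (1 - 0)"
    by (rule Lim_transform_eventually)
  then show ?thesis by (simp add: s_def)
qed

end
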